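(* Let $X$ be a normed space and $C\subset X$ a closed cone such that $\overline{C^*-C^*}=X^*$ (norm closure in $X^*$). Then the following two assertions are equivalent: (P) If $C$ has a bounded base, then for every weakly compact convex subset $A$ of $X$ one has $Max(A,C)\subset\overline{Pos(A,C)}^{\|\cdot\|}$. (G) If $C$ has a base and $0_X$ is a point of continuity for $C$, then for every weakly compact convex subset $A$ of $X$ one has $Max(A,C)\subset\overline{Pos(A,C)}^{\|\cdot\|}$.
   Context: Normed spaces are real and not assumed complete; $0_X$ is the origin; $\overline{\,\cdot\,}^{\|\cdot\|}$ is norm closure. A cone is a nonempty convex subset $C\subset X$ with $\alpha C\subset C$ for all real $\alpha\ge0$. The dual cone is $C^*=\{f\in X^*: f(c)\ge0\ \forall c\in C\}$. A base for a cone $C$ is a nonempty convex subset $B\subset C$ such that $0_X\notin\overline{B}$ and each $c\in C\setminus\{0_X\}$ has a unique representation $c=\lambda b$ with $\lambda>0$ and $b\in B$; it is a bounded base if it is a bounded subset of $X$. The origin $0_X$ is a point of continuity for $C$ if the identity map $(C,\text{weak})\to(C,\|\cdot\|)$ is continuous at $0_X$. For $A\subset X$: $Max(A,C)=\{x\in A:\{x\}=A\cap(x+C)\}$. The set of strictly positive functionals is $C^{\#}=\{f\in X^*: f(c)>0\ \forall c\in C,\ c\ne0_X\}$, and $Pos(A,C)=\{x\in A:\exists f\in C^{\#},\ f(x)=\sup_A f\}$. *)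

theory Defs
  imports "HOL-Analysis.Analysis"
begin

definition dual_cone :: "'a::real_normed_vector set \<Rightarrow> ('a \<Rightarrow>\<^sub>L real) set" where
  "dual_cone C = {f. \<forall>c\<in>C. blinfun_apply f c \<ge> 0}"

definition is_base :: "'a::real_normed_vector set \<Rightarrow> 'a set \<Rightarrow> bool" where
  "is_base C B \<longleftrightarrow>
     B \<noteq> {} \<and> convex B \<and> B \<subseteq> C \<and> 0 \<notin> closure B \<and>
     (\<forall>c\<in>C - {0}. \<exists>!(l, b). l > 0 \<and> b \<in> B \<and> c = l *\<^sub>R b)"

definition has_base :: "'a::real_normed_vector set \<Rightarrow> bool" where
  "has_base C \<longleftrightarrow> (\<exists>B. is_base C B)"

definition has_bounded_base :: "'a::real_normed_vector set \<Rightarrow> bool" where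
  "has_bounded_base C \<longleftrightarrow> (\<exists>B. is_base C B \<and> bounded B)"

definition weak_topology :: "'a::real_normed_vector topology" where
  "weak_topology =
     topology_generated_by {blinfun_apply f -` U | (f :: 'a \<Rightarrow>\<^sub>L real) U. open U}"

definition zero_point_of_continuity :: "'a::real_normed_vector set \<Rightarrow> bool" where
  "zero_point_of_continuity C \<longleftrightarrow>
     topcontinuous_at (subtopology weak_topology C) (top_of_set C) (\<lambda>x. x) 0"

definition Max_points :: "'a::real_normed_vector set \<Rightarrow> 'a set \<Rightarrow> 'a set" where
  "Max_points A C = {x \<in> A. {x} = A \<inter> (+) x ` C}"

definition strictly_positive :: "'a::real_normed_vector set \<Rightarrow> ('a \<Rightarrow>\<^sub>L real) set" where
  "strictly_positive C = {f. \<forall>c\<in>C. c \<noteq> 0 \<longrightarrow> blinfun_apply f c > 0}"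

(* The supremum is taken in ereal because Sup on real is unspecified for unbounded sets. *)
definition Pos_points :: "'a::real_normed_vector set \<Rightarrow> 'a set \<Rightarrow> 'a set" where
  "Pos_points A C =
     {x \<in> A. \<exists>f\<in>strictly_positive C.
        ereal (blinfun_apply f x) = (SUP a\<in>A. ereal (blinfun_apply f a))}"

end

theory Submission
  imports Defs
begin

text \<open>
  The conclusions of the two implications are literally the same density statement, so it suffices
  that their hypotheses agree: a cone \<open>C\<close> has a bounded base if and only if it has a base and the
  origin is a point of continuity for \<open>C\<close>. Both properties are compared with the existence of a
  bounded functional \<open>f\<close> and a constant \<open>d > 0\<close> such that \<open>d * norm c \<le> f c\<close> on \<open>C\<close>.

  Such an \<open>f\<close> cuts out the bounded base \<open>{c \<in> C. f c = 1}\<close> of a nonzero cone (the zero cone has no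
  base at all, which is why the existence of a base has to accompany the point of continuity), and the weakly open
  half space \<open>f < d * e\<close> meets \<open>C\<close> only in vectors of norm less than \<open>e\<close>, so that the origin is a
  point of continuity.

  In the other direction, a functional at least \<open>\<delta> > 0\<close> on a bounded base exists by Hahn-Banach,
  since the base is convex and stays away from the origin; boundedness of the base turns \<open>\<delta>\<close> into a
  multiple of the norm (\<open>bounded_base_imp_norming\<close>). If instead
  the origin is a point of continuity, finitely many functionals control the norm on \<open>C\<close> near the
  origin. Density of \<open>C\<^sup>* - C\<^sup>*\<close> replaces them by a single functional of \<open>C\<^sup>*\<close>, up to
  a small multiple of the norm (\<open>finite_functionals_dominated\<close>), and by homogeneity that error can be
  evaluated on the unit sphere alone (\<open>point_of_continuity_imp_norming\<close>).

  The Hahn-Banach theorem is obtained in the Mazur-Orlicz form: a functional that is minimal among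
  the sublinear functionals below a given one is linear. One construction, lowering a sublinear
  functional along a convex cone of constraints (\<open>sublinear_lower_along_cone\<close>), serves twice: along
  a ray it shows that minimal functionals are odd, and along a general cone it forces the bounds that
  the linear functional has to satisfy.
\<close>

section \<open>Sublinear functionals and the Mazur-Orlicz theorem\<close>

text \<open>Homogeneity is only required as an inequality, which is what infima of sublinear functionals
  inherit directly; \<open>sublinear_scale\<close> recovers the equation.\<close>

definition sublinear :: "('a::real_vector \<Rightarrow> real) \<Rightarrow> bool" where
  "sublinear q \<longleftrightarrow>
     (\<forall>x y. q (x + y) \<le> q x + q y) \<and> (\<forall>t x. t \<ge> 0 \<longrightarrow> q (t *\<^sub>R x) \<le> t * q x)"

lemma sublinear_add: "sublinear q \<Longrightarrow> q (x + y) \<le> q x + q y"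
  by (simp add: sublinear_def)

lemma sublinear_zero:
  assumes "sublinear q"
  shows "q 0 = 0"
proof -
  have "q (0 *\<^sub>R 0) \<le> 0 * q 0"
    using assms unfolding sublinear_def by blast
  moreover have "q (0 + 0) \<le> q 0 + q 0"
    using assms by (rule sublinear_add)
  ultimately show ?thesis by simp
qed

lemma sublinear_scale:
  assumes q: "sublinear q" and "t \<ge> 0"
  shows "q (t *\<^sub>R x) = t * q x"
proof (cases "t = 0")
  case True
  then show ?thesis by (simp add: sublinear_zero[OF q])
next
  case False
  with \<open>t \<ge> 0\<close> have t: "t > 0" by simp
  have "q (inverse t *\<^sub>R (t *\<^sub>R x)) \<le> inverse t * q (t *\<^sub>R x)"
    using q t unfolding sublinear_def by (meson inverse_nonnegative_iff_nonnegative less_imp_le)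
  then have "t * q x \<le> q (t *\<^sub>R x)"
    using t by (simp add: field_simps)
  moreover have "q (t *\<^sub>R x) \<le> t * q x"
    using q t by (simp add: sublinear_def)
  ultimately show ?thesis by simp
qed

lemma sublinear_minus_le:
  assumes "sublinear q"
  shows "- q (- x) \<le> q x"
  using sublinear_add[OF assms, of x "- x"] sublinear_zero[OF assms] by simp

lemma sublinear_norm: "sublinear norm"
  by (simp add: sublinear_def norm_triangle_ineq)

lemma le_cINF_add:
  fixes f :: "'i \<Rightarrow> real" and g :: "'j \<Rightarrow> real"
  assumes "A \<noteq> {}" "B \<noteq> {}" and le: "\<And>a b. a \<in> A \<Longrightarrow> b \<in> B \<Longrightarrow> z \<le> f a + g b"
  shows "z \<le> (INF a\<in>A. f a) + (INF b\<in>B. g b)"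
proof -
  have "z - f a \<le> (INF b\<in>B. g b)" if "a \<in> A" for a
    using le[OF that] by (intro cINF_greatest assms) (simp add: algebra_simps)
  then have "z - (INF b\<in>B. g b) \<le> (INF a\<in>A. f a)"
    by (intro cINF_greatest assms) (simp add: algebra_simps)
  then show ?thesis by simp
qed

lemma le_cINF_mult:
  fixes f :: "'i \<Rightarrow> real"
  assumes "A \<noteq> {}" "t \<ge> 0" and le: "\<And>a. a \<in> A \<Longrightarrow> z \<le> t * f a"
  shows "z \<le> t * (INF a\<in>A. f a)"
proof (cases "t = 0")
  case True
  then show ?thesis using assms by auto
next
  case False
  with \<open>t \<ge> 0\<close> have t: "t > 0" by simp
  have "z / t \<le> (INF a\<in>A. f a)"
    using le t by (intro cINF_greatest assms) (simp add: field_simps)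
  then show ?thesis using t by (simp add: field_simps)
qed

text \<open>The new functional is the infimum of \<open>q (x + v) - s\<close> over the constraints \<open>(v, s) \<in> S\<close>, a cone
  version of the one-dimensional extension step in the usual Hahn-Banach argument. The hypothesis
  \<open>s \<le> q v\<close> keeps the infimum finite, and since \<open>S\<close> is a convex cone the infimum is again
  sublinear.\<close>

lemma sublinear_lower_along_cone:
  fixes q :: "'a::real_vector \<Rightarrow> real" and S :: "('a \<times> real) set"
  assumes q: "sublinear q" and S: "convex_cone S"
    and le: "\<And>v s. (v, s) \<in> S \<Longrightarrow> s \<le> q v"
  obtains r where "sublinear r" "r \<le> q" "\<And>v s. (v, s) \<in> S \<Longrightarrow> r (- v) \<le> - s"
proof -
  define g where "g x p = q (x + fst p) - snd p" for x and p :: "'a \<times> real"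
  define r where "r x = (INF p\<in>S. g x p)" for x
  have ne: "S \<noteq> {}" using S by (rule convex_cone_nonempty)
  have "- q (- x) \<le> g x p" if "p \<in> S" for x p
    using le[of "fst p" "snd p"] that sublinear_add[OF q, of "x + fst p" "- x"]
    by (simp add: g_def)
  then have bdd: "bdd_below (g x ` S)" for x
    by (intro bdd_belowI2)
  have r_le: "r x \<le> g x p" if "p \<in> S" for x p
    unfolding r_def using bdd that by (rule cINF_lower)
  show thesis
  proof
    show "sublinear r"
      unfolding sublinear_def
    proof (intro conjI allI impI)
      fix x y
      show "r (x + y) \<le> r x + r y"
        unfolding r_def[of x] r_def[of y]
      proof (rule le_cINF_add[OF ne ne])
        fix a b assume ab: "a \<in> S" "b \<in> S"
        have "r (x + y) \<le> g (x + y) (a + b)"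
          using convex_cone_add[OF S ab] by (rule r_le)
        also have "\<dots> \<le> g x a + g y b"
          using sublinear_add[OF q, of "x + fst a" "y + fst b"] by (simp add: g_def algebra_simps)
        finally show "r (x + y) \<le> g x a + g y b" .
      qed
    next
      fix t :: real and x assume t: "t \<ge> 0"
      show "r (t *\<^sub>R x) \<le> t * r x"
        unfolding r_def[of x]
      proof (rule le_cINF_mult[OF ne t])
        fix a assume a: "a \<in> S"
        have "r (t *\<^sub>R x) \<le> g (t *\<^sub>R x) (t *\<^sub>R a)"
          using convex_cone_scaleR[OF S t a] by (rule r_le)
        also have "\<dots> = t * g x a"
          using sublinear_scale[OF q t, of "x + fst a"] by (simp add: g_def algebra_simps)
        finally show "r (t *\<^sub>R x) \<le> t * g x a" .
      qed
    qed
    show "r \<le> q"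
      using r_le[OF convex_cone_contains_0[OF S]] by (simp add: le_fun_def g_def)
    show "r (- v) \<le> - s" if "(v, s) \<in> S" for v s
      using r_le[OF that, of "- v"] sublinear_zero[OF q] by (simp add: g_def)
  qed
qed

text \<open>Lower \<open>m\<close> along the ray through \<open>(y, m y)\<close>. By minimality nothing changes, which says
  \<open>m (- y) \<le> - m y\<close>, so \<open>m\<close> is odd. Subadditivity at \<open>- x\<close> and \<open>- y\<close> then gives the reverse
  inequality at \<open>x\<close> and \<open>y\<close>.\<close>

lemma minimal_sublinear_imp_linear:
  fixes m :: "'a::real_vector \<Rightarrow> real"
  assumes m: "sublinear m" and min: "\<And>r. sublinear r \<Longrightarrow> r \<le> m \<Longrightarrow> r = m"
  shows "linear m"
proof -
  have odd: "m (- y) = - m y" for y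
  proof -
    define S where "S = conic hull {(y, m y)}"
    have S_iff: "p \<in> S \<longleftrightarrow> (\<exists>t\<ge>0. p = t *\<^sub>R (y, m y))" for p
      by (auto simp: S_def conic_hull_explicit)
    have "convex_cone S"
      by (simp add: S_def convex_cone_def convex_conic_hull conic_conic_hull conic_hull_eq_empty)
    moreover have "s \<le> m v" if "(v, s) \<in> S" for v s
      using that by (auto simp: S_iff sublinear_scale[OF m])
    ultimately obtain r where r: "sublinear r" "r \<le> m" "\<And>v s. (v, s) \<in> S \<Longrightarrow> r (- v) \<le> - s"
      using sublinear_lower_along_cone[OF m] by metis
    have "(y, m y) \<in> S" by (auto simp: S_iff intro!: exI[of _ 1])
    then have "m (- y) \<le> - m y"
      using r min by metis
    then show ?thesis
      using sublinear_minus_le[OF m, of y] by simp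
  qed
  show ?thesis
  proof (rule linearI)
    fix x y
    have "m (- x + - y) \<le> m (- x) + m (- y)"
      using m by (rule sublinear_add)
    then have "m x + m y \<le> m (x + y)"
      using odd[of "x + y"] by (simp add: odd)
    then show "m (x + y) = m x + m y"
      using sublinear_add[OF m, of x y] by simp
  next
    fix t x
    show "m (t *\<^sub>R x) = t *\<^sub>R m x"
    proof (cases "t \<ge> 0")
      case True
      then show ?thesis by (simp add: sublinear_scale[OF m])
    next
      case False
      then have "m ((- t) *\<^sub>R x) = (- t) * m x"
        by (intro sublinear_scale[OF m]) simp
      then show ?thesis using odd[of "t *\<^sub>R x"] by simp
    qed
  qed
qed

text \<open>Zorn's lemma: a chain of sublinear functionals below \<open>q\<close> is bounded below pointwise by
  \<open>- q (- x)\<close>, and its pointwise infimum is sublinear because any two members are comparable.\<close>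

lemma ex_minimal_sublinear_below:
  fixes q :: "'a::real_vector \<Rightarrow> real"
  assumes q: "sublinear q"
  obtains m where "sublinear m" "m \<le> q" "\<And>r. sublinear r \<Longrightarrow> r \<le> m \<Longrightarrow> r = m"
proof -
  define A where "A = {r. sublinear r \<and> r \<le> q}"
  define P where "P a b \<longleftrightarrow> b \<le> a" for a b :: "'a \<Rightarrow> real"
  have "\<exists>m\<in>A. \<forall>a\<in>A. P m a \<longrightarrow> a = m"
  proof (rule predicate_Zorn)
    show "partial_order_on A (relation_of P A)"
      unfolding P_def by (intro partial_order_on_relation_ofI) auto
  next
    fix \<C> assume "\<C> \<in> Chains (relation_of P A)"
    then have sub: "\<C> \<subseteq> A" and comp: "\<And>a b. a \<in> \<C> \<Longrightarrow> b \<in> \<C> \<Longrightarrow> a \<le> b \<or> b \<le> a"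
      by (auto simp: Chains_def relation_of_def P_def)
    show "\<exists>u\<in>A. \<forall>a\<in>\<C>. P a u"
    proof (cases "\<C> = {}")
      case True
      then show ?thesis using q by (auto simp: A_def)
    next
      case ne: False
      define u where "u x = (INF r\<in>\<C>. r x)" for x
      have "- q (- x) \<le> r x" if "r \<in> \<C>" for r x
      proof -
        have r: "sublinear r" "r \<le> q" using that sub by (auto simp: A_def)
        show ?thesis
          using sublinear_minus_le[OF r(1), of x] le_funD[OF r(2), of "- x"] by linarith
      qed
      then have bdd: "bdd_below ((\<lambda>r. r x) ` \<C>)" for x
        by (intro bdd_belowI2)
      have u_le: "u x \<le> r x" if "r \<in> \<C>" for r x
        unfolding u_def using bdd that by (rule cINF_lower)
      have "sublinear u"
        unfolding sublinear_def
      proof (intro conjI allI impI)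
        fix x y
        show "u (x + y) \<le> u x + u y"
          unfolding u_def[of x] u_def[of y]
        proof (rule le_cINF_add[OF ne ne])
          fix a b assume ab: "a \<in> \<C>" "b \<in> \<C>"
          then obtain r where r: "r \<in> \<C>" "r \<le> a" "r \<le> b"
            using comp by blast
          then have "sublinear r" using sub by (auto simp: A_def)
          then show "u (x + y) \<le> a x + b y"
            using u_le[OF r(1), of "x + y"] sublinear_add[of r x y]
              le_funD[OF r(2), of x] le_funD[OF r(3), of y] by linarith
        qed
      next
        fix t :: real and x assume t: "t \<ge> 0"
        show "u (t *\<^sub>R x) \<le> t * u x"
          unfolding u_def[of x]
        proof (rule le_cINF_mult[OF ne t])
          fix r assume r: "r \<in> \<C>"
          then have "sublinear r" using sub by (auto simp: A_def)
          then show "u (t *\<^sub>R x) \<le> t * r x"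
            using u_le[OF r, of "t *\<^sub>R x"] t by (simp add: sublinear_scale)
        qed
      qed
      moreover obtain r where "r \<in> \<C>" using ne by blast
      then have "u \<le> q"
        using u_le sub by (force simp: A_def le_fun_def intro: order_trans)
      ultimately show ?thesis
        using u_le by (auto simp: A_def P_def le_fun_def intro!: bexI[of _ u])
    qed
  qed
  then obtain m where m: "m \<in> A" "\<And>a. a \<in> A \<Longrightarrow> a \<le> m \<Longrightarrow> a = m"
    by (auto simp: P_def)
  show thesis
  proof
    show "sublinear m" "m \<le> q" using m(1) by (auto simp: A_def)
    then show "r = m" if "sublinear r" "r \<le> m" for r
      using that m(2)[of r] by (auto simp: A_def)
  qed
qed

text \<open>A linear \<open>f\<close> below the lowered functional \<open>r\<close> satisfies \<open>- f v = f (- v) \<le> r (- v) \<le> - s\<close>, so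
  upper bounds at \<open>- v\<close> become the required lower bounds at \<open>v\<close>.\<close>

theorem mazur_orlicz:
  fixes q :: "'a::real_vector \<Rightarrow> real" and S :: "('a \<times> real) set"
  assumes "sublinear q" "convex_cone S" "\<And>v s. (v, s) \<in> S \<Longrightarrow> s \<le> q v"
  obtains f where "linear f" "\<And>x. f x \<le> q x" "\<And>v s. (v, s) \<in> S \<Longrightarrow> s \<le> f v"
proof -
  obtain r where r: "sublinear r" "r \<le> q" "\<And>v s. (v, s) \<in> S \<Longrightarrow> r (- v) \<le> - s"
    using sublinear_lower_along_cone[OF assms] by metis
  obtain f where f: "sublinear f" "f \<le> r" "\<And>p. sublinear p \<Longrightarrow> p \<le> f \<Longrightarrow> p = f"
    using ex_minimal_sublinear_below[OF r(1)] by metis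
  show thesis
  proof
    show lin: "linear f" using f(1,3) by (rule minimal_sublinear_imp_linear)
    show "f x \<le> q x" for x
      using f(2) r(2) by (meson le_funD order_trans)
    show "s \<le> f v" if "(v, s) \<in> S" for v s
      using r(3)[OF that] le_funD[OF f(2), of "- v"] linear_neg[OF lin, of v] by linarith
  qed
qed

text \<open>The dominating sublinear functional is the norm, which makes the resulting linear functional
  bounded, and the constraints \<open>f b \<ge> d\<close> for \<open>b \<in> B\<close> generate the cone \<open>S\<close>.\<close>

lemma separate_convex_from_zero:
  fixes B :: "'a::real_normed_vector set"
  assumes "convex B" "0 \<notin> closure B"
  shows "\<exists>(f :: 'a \<Rightarrow>\<^sub>L real) d. d > 0 \<and> (\<forall>b\<in>B. d \<le> blinfun_apply f b)"
proof (cases "B = {}")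
  case True
  then show ?thesis by (simp add: gt_ex)
next
  case False
  obtain d where d: "d > 0" "\<And>b. b \<in> B \<Longrightarrow> d \<le> norm b"
    using assms(2) by (auto simp: closure_approachable not_less)
  define S where "S = conic hull (B \<times> {d})"
  have S_eq: "S = {(t *\<^sub>R b, t * d) | t b. t \<ge> 0 \<and> b \<in> B}"
    by (force simp: S_def conic_hull_explicit)
  have "convex_cone S"
    using False assms(1)
    by (simp add: S_def convex_cone_def convex_conic_hull conic_conic_hull conic_hull_eq_empty
        convex_Times)
  moreover have "s \<le> norm v" if "(v, s) \<in> S" for v s
    using that d(2) by (auto simp: S_eq intro!: mult_left_mono)
  ultimately obtain f where f: "linear f" "\<And>x. f x \<le> norm x" "\<And>v s. (v, s) \<in> S \<Longrightarrow> s \<le> f v"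
    using mazur_orlicz[OF sublinear_norm] by metis
  have "norm (f x) \<le> norm x * 1" for x
    using f(2)[of x] f(2)[of "- x"] linear_neg[OF f(1), of x] by (simp add: abs_le_iff)
  then have bl: "bounded_linear f"
    using f(1) by (intro bounded_linear_intro[where K = 1]) (auto simp: linear_add linear_scale)
  show ?thesis
  proof (intro exI conjI ballI)
    show "d > 0" by fact
    fix b assume "b \<in> B"
    then have "(1 *\<^sub>R b, 1 * d) \<in> S" unfolding S_eq by fastforce
    then show "d \<le> blinfun_apply (Blinfun f) b"
      using f(3) by (simp add: bounded_linear_Blinfun_apply[OF bl])
  qed
qed

section \<open>Functionals that control the norm on a cone\<close>

definition norming_functional :: "'a::real_normed_vector set \<Rightarrow> ('a \<Rightarrow>\<^sub>L real) \<Rightarrow> real \<Rightarrow> bool" where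
  "norming_functional C f d \<longleftrightarrow> d > 0 \<and> (\<forall>c\<in>C. d * norm c \<le> blinfun_apply f c)"

lemma is_base_decompose:
  assumes "is_base C B" "c \<in> C" "c \<noteq> 0"
  obtains l b where "l > 0" "b \<in> B" "c = l *\<^sub>R b"
  using assms unfolding is_base_def by blast

text \<open>Bases are nonempty and avoid the origin, so the zero cone has none.\<close>

lemma has_base_imp_nonzero:
  assumes "has_base C"
  obtains c where "c \<in> C" "c \<noteq> 0"
proof -
  obtain B where "B \<noteq> {}" "B \<subseteq> C" "0 \<notin> closure B"
    using assms unfolding has_base_def is_base_def by blast
  moreover have "B \<subseteq> closure B" by (rule closure_subset)
  ultimately show thesis using that by blast
qed

text \<open>For \<open>f \<ge> d\<close> on a base whose elements have norm at most \<open>M\<close>, a multiple \<open>l b\<close> of a base element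
  has norm at most \<open>l M\<close> while \<open>f (l b) \<ge> l d\<close>.\<close>

lemma bounded_base_imp_norming:
  fixes C :: "'a::real_normed_vector set"
  assumes "has_bounded_base C"
  obtains f d where "norming_functional C f d"
proof -
  obtain B where B: "is_base C B" "bounded B"
    using assms unfolding has_bounded_base_def by blast
  have "convex B" "0 \<notin> closure B"
    using B(1) unfolding is_base_def by simp_all
  then obtain f :: "'a \<Rightarrow>\<^sub>L real" and d
    where f: "d > 0" "\<And>b. b \<in> B \<Longrightarrow> d \<le> blinfun_apply f b"
    using separate_convex_from_zero[of B] by blast
  obtain M where M: "M > 0" "\<And>b. b \<in> B \<Longrightarrow> norm b \<le> M"
    using B(2) unfolding bounded_pos by blast
  have "d / M * norm c \<le> blinfun_apply f c" if c: "c \<in> C" for c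
  proof (cases "c = 0")
    case False
    then obtain l b where l: "l > 0" "b \<in> B" "c = l *\<^sub>R b"
      using is_base_decompose[OF B(1) c] by blast
    have "d * norm b \<le> d * M"
      using M(2)[OF l(2)] f(1) by simp
    also have "\<dots> \<le> blinfun_apply f b * M"
      using f(2)[OF l(2)] M(1) by simp
    finally have "d / M * norm b \<le> blinfun_apply f b"
      using M(1) by (simp add: field_simps)
    then show ?thesis
      using l mult_left_mono[of "d / M * norm b" "blinfun_apply f b" l]
      by (simp add: blinfun.scaleR_right algebra_simps)
  qed simp
  then show thesis
    using that[of f "d / M"] f(1) M(1) unfolding norming_functional_def by simp
qed

text \<open>The base is the slice \<open>f c = 1\<close>. The estimate \<open>d * norm c \<le> f c\<close> makes \<open>f\<close> strictly positive, so
  every nonzero vector of \<open>C\<close> can be normalized into the slice, and it bounds the slice by \<open>1 / d\<close>.\<close>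

lemma norming_imp_bounded_base:
  assumes C: "convex_cone C" and f: "norming_functional C f d" and c0: "c0 \<in> C" "c0 \<noteq> 0"
  shows "has_bounded_base C"
proof -
  define B where "B = {c \<in> C. blinfun_apply f c = 1}"
  have d: "d > 0" and le: "\<And>c. c \<in> C \<Longrightarrow> d * norm c \<le> blinfun_apply f c"
    using f unfolding norming_functional_def by auto
  have pos: "blinfun_apply f c > 0" if "c \<in> C" "c \<noteq> 0" for c
    using le[OF that(1)] d that(2) by (smt (verit) mult_pos_pos zero_less_norm_iff)
  have normalize: "(1 / blinfun_apply f c) *\<^sub>R c \<in> B" if "c \<in> C" "c \<noteq> 0" for c
    using pos[OF that] convex_cone_scaleR[OF C, of "1 / blinfun_apply f c" c] that
    by (simp add: B_def blinfun.scaleR_right)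
  have "is_base C B"
    unfolding is_base_def
  proof (intro conjI ballI)
    show "B \<noteq> {}" using normalize[OF c0] by blast
    show "convex B"
    proof -
      have "B = C \<inter> blinfun_apply f -` {1}" by (auto simp: B_def)
      moreover have "convex (blinfun_apply f -` {1})"
        by (intro convex_linear_vimage convex_singleton)
          (simp add: blinfun.bounded_linear_right bounded_linear.linear)
      ultimately show ?thesis using C by (simp add: convex_Int convex_cone_def)
    qed
    show "B \<subseteq> C" by (auto simp: B_def)
    show "0 \<notin> closure B"
    proof -
      have "closed {c. blinfun_apply f c = 1}"
        by (intro closed_Collect_eq continuous_intros)
      then have "closure B \<subseteq> {c. blinfun_apply f c = 1}"
        by (intro closure_minimal) (auto simp: B_def)
      then show ?thesis by auto
    qed
    fix c assume c: "c \<in> C - {0}"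
    define l where "l = blinfun_apply f c"
    have l: "l > 0" using pos c by (simp add: l_def)
    show "\<exists>!(l, b). l > 0 \<and> b \<in> B \<and> c = l *\<^sub>R b"
    proof (rule ex1I[of _ "(l, (1 / l) *\<^sub>R c)"])
      show "case (l, (1 / l) *\<^sub>R c) of (l, b) \<Rightarrow> l > 0 \<and> b \<in> B \<and> c = l *\<^sub>R b"
        using l normalize[of c] c by (simp add: l_def)
    next
      fix p assume "case p of (l, b) \<Rightarrow> l > 0 \<and> b \<in> B \<and> c = l *\<^sub>R b"
      then obtain k b where p: "p = (k, b)" "k > 0" "b \<in> B" "c = k *\<^sub>R b"
        by (cases p) auto
      then have "l = k" by (simp add: l_def B_def blinfun.scaleR_right)
      then show "p = (l, (1 / l) *\<^sub>R c)" using p by simp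
    qed
  qed
  moreover have "bounded B"
  proof (rule boundedI)
    fix b assume "b \<in> B"
    then show "norm b \<le> 1 / d"
      using le[of b] d by (simp add: B_def field_simps)
  qed
  ultimately show ?thesis unfolding has_bounded_base_def by blast
qed

section \<open>The weak topology at the origin\<close>

lemma topspace_weak_topology [simp]: "topspace (weak_topology :: 'a::real_normed_vector topology) = UNIV"
proof -
  have "blinfun_apply 0 -` UNIV \<in> {blinfun_apply f -` U | (f :: 'a \<Rightarrow>\<^sub>L real) U. open U}"
    using open_UNIV by blast
  then show ?thesis
    unfolding weak_topology_def topology_generated_by_topspace by auto
qed

lemma openin_weak_vimage:
  fixes f :: "'a::real_normed_vector \<Rightarrow>\<^sub>L real"
  shows "open U \<Longrightarrow> openin weak_topology (blinfun_apply f -` U)"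
  unfolding weak_topology_def
  by (rule topology_generated_by_Basis) blast

lemma weak_neighbourhood_of_zero:
  fixes U :: "'a::real_normed_vector set"
  assumes "openin weak_topology U" "0 \<in> U"
  shows "\<exists>F e. finite (F :: ('a \<Rightarrow>\<^sub>L real) set) \<and> e > 0 \<and>
    {x. \<forall>f\<in>F. \<bar>blinfun_apply f x\<bar> < e} \<subseteq> U"
proof -
  have "generate_topology_on {blinfun_apply f -` U | (f :: 'a \<Rightarrow>\<^sub>L real) U. open U} U"
    using assms(1) unfolding weak_topology_def by (rule openin_topology_generated_by)
  then show ?thesis
    using assms(2)
  proof induction
    case Empty
    then show ?case by simp
  next
    case (Int a b)
    then obtain F G :: "('a \<Rightarrow>\<^sub>L real) set" and e e' where
      F: "finite F" "e > 0" "{x. \<forall>f\<in>F. \<bar>blinfun_apply f x\<bar> < e} \<subseteq> a" and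
      G: "finite G" "e' > 0" "{x. \<forall>f\<in>G. \<bar>blinfun_apply f x\<bar> < e'} \<subseteq> b"
      by blast
    have "{x. \<forall>f\<in>F \<union> G. \<bar>blinfun_apply f x\<bar> < min e e'} \<subseteq> a \<inter> b"
      using F(3) G(3) by (auto simp: subset_iff)
    then show ?case
      using F(1,2) G(1,2) by (intro exI[of _ "F \<union> G"] exI[of _ "min e e'"]) simp
  next
    case (UN K)
    then obtain k where k: "k \<in> K" "0 \<in> k" by blast
    with UN.IH obtain F e where "finite (F :: ('a \<Rightarrow>\<^sub>L real) set)" "e > 0"
      "{x. \<forall>f\<in>F. \<bar>blinfun_apply f x\<bar> < e} \<subseteq> k"
      by blast
    then show ?case using k(1) by (blast intro: order_trans)
  next
    case (Basis s)
    then obtain f :: "'a \<Rightarrow>\<^sub>L real" and V where s: "s = blinfun_apply f -` V" "open V" "0 \<in> V"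
      by auto
    then obtain e where e: "e > 0" "ball 0 e \<subseteq> V"
      by (meson open_contains_ball)
    then have "{x. \<forall>g\<in>{f}. \<bar>blinfun_apply g x\<bar> < e} \<subseteq> s"
      by (auto simp: s(1) subset_iff)
    then show ?case using e(1) by (intro exI[of _ "{f}"] exI[of _ e]) simp
  qed
qed

text \<open>A single functional suffices for the weak neighbourhood: on \<open>C\<close>, \<open>f c < d * e\<close> forces
  \<open>norm c < e\<close>.\<close>

lemma norming_imp_point_of_continuity:
  assumes C: "convex_cone C" and f: "norming_functional C f d"
  shows "zero_point_of_continuity C"
  unfolding zero_point_of_continuity_def topcontinuous_at_def
proof (intro conjI allI impI)
  show "0 \<in> topspace (subtopology weak_topology C)"
    using C by (simp add: convex_cone_contains_0)
  show "(\<lambda>x. x) \<in> topspace (subtopology weak_topology C) \<rightarrow> topspace (top_of_set C)"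
    by simp
  fix V assume V: "openin (top_of_set C) V \<and> 0 \<in> V"
  then obtain e where e: "e > 0" "ball 0 e \<inter> C \<subseteq> V"
    unfolding openin_contains_ball by blast
  define U where "U = blinfun_apply f -` {..<d * e} \<inter> C"
  have d: "d > 0" and le: "\<And>c. c \<in> C \<Longrightarrow> d * norm c \<le> blinfun_apply f c"
    using f unfolding norming_functional_def by auto
  have "openin (subtopology weak_topology C) U"
    unfolding U_def by (intro openin_subtopology_Int openin_weak_vimage) simp
  moreover have "0 \<in> U"
    using C d e by (simp add: U_def convex_cone_contains_0)
  moreover have "y \<in> V" if "y \<in> U" for y
  proof -
    have y: "y \<in> C" "blinfun_apply f y < d * e" using that by (auto simp: U_def)
    then have "d * norm y < d * e" using le[OF y(1)] by linarith
    then have "norm y < e" using d by simp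
    then show ?thesis using e(2) y(1) by auto
  qed
  ultimately show "\<exists>U. openin (subtopology weak_topology C) U \<and> 0 \<in> U \<and> (\<forall>y\<in>U. y \<in> V)"
    by blast
qed

text \<open>Approximate each functional within \<open>e\<close> by a difference \<open>g - h\<close> with \<open>g, h\<close> in the dual cone; on
  \<open>C\<close> this difference is at most \<open>g + h\<close> in absolute value. Adding up the sums \<open>g + h\<close> dominates the
  whole finite set, since all summands are nonnegative on \<open>C\<close>.\<close>

lemma finite_functionals_dominated:
  fixes C :: "'a::real_normed_vector set" and F :: "('a \<Rightarrow>\<^sub>L real) set"
  assumes dense: "closure {f - g | f g. f \<in> dual_cone C \<and> g \<in> dual_cone C} = UNIV"
    and "finite F" "e > 0"
  shows "\<exists>\<phi>\<in>dual_cone C. \<forall>f\<in>F. \<forall>c\<in>C. \<bar>blinfun_apply f c\<bar> \<le> blinfun_apply \<phi> c + e * norm c"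
  using \<open>finite F\<close>
proof induction
  case empty
  have "0 \<in> dual_cone C" by (simp add: dual_cone_def)
  then show ?case by blast
next
  case (insert f F)
  then obtain \<phi> where \<phi>: "\<phi> \<in> dual_cone C"
    "\<And>f c. f \<in> F \<Longrightarrow> c \<in> C \<Longrightarrow> \<bar>blinfun_apply f c\<bar> \<le> blinfun_apply \<phi> c + e * norm c"
    by blast
  have "f \<in> closure {f - g | f g. f \<in> dual_cone C \<and> g \<in> dual_cone C}"
    using dense by simp
  then obtain g h where gh: "g \<in> dual_cone C" "h \<in> dual_cone C" "dist (g - h) f < e"
    using \<open>e > 0\<close> unfolding closure_approachable by blast
  have f: "\<bar>blinfun_apply f c\<bar> \<le> blinfun_apply (g + h) c + e * norm c" if c: "c \<in> C" for c
  proof -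
    have "norm (blinfun_apply (g - h - f) c) \<le> norm (g - h - f) * norm c"
      by (rule norm_blinfun)
    also have "\<dots> \<le> e * norm c"
      using gh(3) by (intro mult_right_mono) (simp_all add: dist_norm)
    finally have "\<bar>blinfun_apply g c - blinfun_apply h c - blinfun_apply f c\<bar> \<le> e * norm c"
      by (simp add: blinfun.diff_left)
    moreover have "blinfun_apply g c \<ge> 0" "blinfun_apply h c \<ge> 0"
      using gh(1,2) c by (auto simp: dual_cone_def)
    ultimately show ?thesis unfolding blinfun.add_left by linarith
  qed
  have nonneg: "blinfun_apply \<phi> c \<ge> 0" "blinfun_apply (g + h) c \<ge> 0" if "c \<in> C" for c
    using that \<phi>(1) gh(1,2) by (auto simp: dual_cone_def blinfun.add_left)
  show ?case
  proof (intro bexI[of _ "\<phi> + (g + h)"] ballI)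
    show "\<phi> + (g + h) \<in> dual_cone C"
      using nonneg by (simp add: dual_cone_def blinfun.add_left)
    fix f' c assume f': "f' \<in> insert f F" and c: "c \<in> C"
    have "\<bar>blinfun_apply f' c\<bar> \<le> blinfun_apply \<phi> c + blinfun_apply (g + h) c + e * norm c"
    proof (cases "f' = f")
      case True
      show ?thesis unfolding True using f[OF c] nonneg(1)[OF c] by linarith
    next
      case False
      then show ?thesis using f' \<phi>(2)[OF _ c, of f'] nonneg(2)[OF c] by simp
    qed
    then show "\<bar>blinfun_apply f' c\<bar> \<le> blinfun_apply (\<phi> + (g + h)) c + e * norm c"
      by (simp only: blinfun.add_left[of \<phi>])
  qed
qed

text \<open>If \<open>\<phi>\<close> dominates, up to \<open>e / 2\<close> times the norm, the functionals of a weak neighbourhood of size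
  \<open>e\<close> on which the norm is less than 1, then \<open>\<phi> \<ge> e / 2\<close> on the unit vectors of \<open>C\<close>: otherwise such
  a vector would lie in that neighbourhood.\<close>

lemma point_of_continuity_imp_norming:
  fixes C :: "'a::real_normed_vector set"
  assumes C: "convex_cone C" and pc: "zero_point_of_continuity C"
    and dense: "closure {f - g | f g. f \<in> dual_cone C \<and> g \<in> dual_cone C} = UNIV"
  obtains f d where "norming_functional C f d"
proof -
  have "openin (top_of_set C) (C \<inter> ball 0 1)" by (rule openin_open_Int) simp
  moreover have "0 \<in> C \<inter> ball 0 1" using convex_cone_contains_0[OF C] by simp
  ultimately have "\<exists>U. openin (subtopology weak_topology C) U \<and> 0 \<in> U \<and> (\<forall>y\<in>U. y \<in> C \<inter> ball 0 1)"
    using pc unfolding zero_point_of_continuity_def topcontinuous_at_def by fast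
  then obtain U where U: "openin (subtopology weak_topology C) U" "0 \<in> U" "U \<subseteq> ball 0 1"
    by (auto simp: subset_iff)
  obtain W where W: "openin weak_topology W" "U = W \<inter> C"
    using U(1) unfolding openin_subtopology by blast
  have "0 \<in> W" using U(2) W(2) by blast
  then obtain F :: "('a \<Rightarrow>\<^sub>L real) set" and e
    where F: "finite F" "e > 0" "{x. \<forall>f\<in>F. \<bar>blinfun_apply f x\<bar> < e} \<subseteq> W"
    using weak_neighbourhood_of_zero[OF W(1)] by blast
  obtain \<phi> where \<phi>: "\<phi> \<in> dual_cone C"
    "\<And>f c. f \<in> F \<Longrightarrow> c \<in> C \<Longrightarrow> \<bar>blinfun_apply f c\<bar> \<le> blinfun_apply \<phi> c + e / 2 * norm c"
    using finite_functionals_dominated[OF dense F(1), of "e / 2"] F(2) by (meson half_gt_zero)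
  have unit: "e / 2 \<le> blinfun_apply \<phi> c" if c: "c \<in> C" "norm c = 1" for c
  proof (rule ccontr)
    assume "\<not> e / 2 \<le> blinfun_apply \<phi> c"
    then have "\<bar>blinfun_apply f c\<bar> < e" if "f \<in> F" for f
      using \<phi>(2)[OF that c(1)] c(2) by simp
    then have "c \<in> U" using F(3) W(2) c(1) by blast
    then show False using U(3) c(2) by auto
  qed
  have "e / 2 * norm c \<le> blinfun_apply \<phi> c" if "c \<in> C" for c
  proof (cases "c = 0")
    case False
    then have "e / 2 \<le> blinfun_apply \<phi> ((1 / norm c) *\<^sub>R c)"
      using that by (intro unit convex_cone_scaleR[OF C]) simp_all
    then show ?thesis using False by (simp add: blinfun.scaleR_right field_simps)
  qed simp
  then show thesis
    using that[of \<phi> "e / 2"] F(2) unfolding norming_functional_def by simp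
qed

section \<open>Bounded bases and points of continuity\<close>

theorem bounded_base_iff_point_of_continuity:
  fixes C :: "'a::real_normed_vector set"
  assumes "convex_cone C"
    and "closure {f - g | f g. f \<in> dual_cone C \<and> g \<in> dual_cone C} = UNIV"
  shows "has_bounded_base C \<longleftrightarrow> has_base C \<and> zero_point_of_continuity C"
proof
  assume bb: "has_bounded_base C"
  then have "has_base C" unfolding has_bounded_base_def has_base_def by blast
  moreover obtain f d where "norming_functional C f d"
    using bb by (rule bounded_base_imp_norming)
  then have "zero_point_of_continuity C"
    by (rule norming_imp_point_of_continuity[OF assms(1)])
  ultimately show "has_base C \<and> zero_point_of_continuity C" ..
next
  assume *: "has_base C \<and> zero_point_of_continuity C"
  then obtain f d where "norming_functional C f d"
    using point_of_continuity_imp_norming[OF assms(1) _ assms(2)] by blast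
  moreover obtain c where "c \<in> C" "c \<noteq> 0"
    using * has_base_imp_nonzero by blast
  ultimately show "has_bounded_base C"
    by (rule norming_imp_bounded_base[OF assms(1)])
qed

theorem corollary2:
  fixes C :: "'a::real_normed_vector set"
  assumes "convex_cone C" and "closed C"
    and "closure {f - g | f g. f \<in> dual_cone C \<and> g \<in> dual_cone C} = UNIV"
  shows "(has_bounded_base C \<longrightarrow>
            (\<forall>A. compactin weak_topology A \<and> convex A \<longrightarrow>
                 Max_points A C \<subseteq> closure (Pos_points A C)))
         \<longleftrightarrow>
         (has_base C \<and> zero_point_of_continuity C \<longrightarrow>
            (\<forall>A. compactin weak_topology A \<and> convex A \<longrightarrow>
                 Max_points A C \<subseteq> closure (Pos_points A C)))"
  by (simp only: bounded_base_iff_point_of_continuity[OF assms(1,3)])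

end
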